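(* Let $G$ be a DAG with nodes the discrete random variables $X_1,\dots,X_n$, let the joint distribution $P$ be Markovian with respect to $G$ (with given causal conditionals), and let $S$ be a set of arrows of $G$. If the causal strength satisfies $\mathfrak{C}_S(P)=0$, then $P$ satisfies the Markov condition with respect to the DAG $G_S$ obtained from $G$ by removing the arrows in $S$.
   Context: $X_1,\dots,X_n$ are discrete random variables, $P(x_1,\dots,x_n)$ is their joint probability mass function, and $PA_j$ is the set of parents of $X_j$ in $G$, with values $pa_j$. $P$ is Markovian with respect to $G$ (satisfies the Markov condition) if every node is conditionally independent of its nondescendants given its parents; equivalently $P(x_1,\dots,x_n)=\prod_{j=1}^n P(x_j|pa_j)$. The causal conditionals $P(X_j|pa_j)$ are assumed to be given (as probability distributions) also for those $pa_j$ with $P(pa_j)=0$. For a set $S$ of arrows of $G$, $PA_j^S$ is the set of parents $X_i$ of $X_j$ with $(X_i\to X_j)\in S$ and $PA_j^{\bar S}$ is the set of the remaining parents of $X_j$; values are written $pa_j^S$, $pa_j^{\bar S}$. Define $$P_S(x_j|pa_j^{\bar S}):=\sum_{pa_j^S}P(x_j|pa_j^{\bar S},pa_j^S)\,P_{\prod}(pa_j^S),$$ where $P_{\prod}(pa_j^S)$ is the product of the marginal distributions (under $P$) of all variables in $PA_j^S$ (if $PA_j^S=\emptyset$ this is just $P(x_j|pa_j)$), and the interventional distribution $P_S(x_1,\dots,x_n):=\prod_j P_S(x_j|pa_j^{\bar S})$. The causal strength (causal influence) of $S$ is the Kullback–Leibler divergence $\mathfrak{C}_S(P):=D(P\|P_S)=\sum_{x}P(x)\log\frac{P(x)}{P_S(x)}$.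 *)

theory Defs
  imports "HOL-Probability.Probability"
begin

text \<open>
  The nodes are the elements of a finite type \<open>'v\<close>, and a directed graph is its set of arrows,
  \<open>(i, j) \<in> E\<close> meaning \<open>X\<^sub>i \<rightarrow> X\<^sub>j\<close>. The variable \<open>X\<^sub>i\<close> takes values in its own countable set
  \<open>Val i\<close>, and \<open>P\<close> is the joint distribution of all variables, a \<open>pmf\<close> on value assignments.
\<close>

definition parents :: "('v \<times> 'v) set \<Rightarrow> 'v \<Rightarrow> 'v set" where
  "parents E j = {i. (i, j) \<in> E}"

text \<open>The closure is reflexive, so a node is not one of its own nondescendants.\<close>

definition nondescendants :: "('v \<times> 'v) set \<Rightarrow> 'v \<Rightarrow> 'v set" where
  "nondescendants E j = {i. (j, i) \<notin> E\<^sup>*}"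

text \<open>
  \<open>P(x\<^sub>A | x\<^sub>C)\<close>, where only the values of \<open>x\<close> on \<open>A \<union> C\<close> matter. It is \<open>0\<close> if \<open>P(x\<^sub>C) = 0\<close>.
\<close>

definition cond_of :: "('v \<Rightarrow> 'a) pmf \<Rightarrow> 'v set \<Rightarrow> 'v set \<Rightarrow> ('v \<Rightarrow> 'a) \<Rightarrow> real" where
  "cond_of P A C x =
     cond_prob (measure_pmf P) (\<lambda>\<omega>. \<forall>i\<in>A. \<omega> i = x i) (\<lambda>\<omega>. \<forall>i\<in>C. \<omega> i = x i)"

text \<open>
  The equation is vacuous (\<open>0 = 0 * 0\<close>) when the conditioning event has probability \<open>0\<close>.
\<close>

definition cond_indep :: "('v \<Rightarrow> 'a) pmf \<Rightarrow> 'v set \<Rightarrow> 'v set \<Rightarrow> 'v set \<Rightarrow> bool" where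
  "cond_indep P A B C \<longleftrightarrow> (\<forall>x. cond_of P (A \<union> B) C x = cond_of P A C x * cond_of P B C x)"

definition markovian :: "('v \<times> 'v) set \<Rightarrow> ('v \<Rightarrow> 'a) pmf \<Rightarrow> bool" where
  "markovian E P \<longleftrightarrow> (\<forall>j. cond_indep P {j} (nondescendants E j) (parents E j))"

text \<open>
  \<open>K j pa\<close> is the causal conditional \<open>P(X\<^sub>j | pa\<^sub>j)\<close>. It is given for every parent assignment, and
  determined by \<open>P\<close> only when that assignment has positive probability.
\<close>

definition causal_conditionals ::
  "('v \<times> 'v) set \<Rightarrow> ('v \<Rightarrow> 'a set) \<Rightarrow> ('v \<Rightarrow> 'a) pmf \<Rightarrow> ('v \<Rightarrow> ('v \<Rightarrow> 'a) \<Rightarrow> 'a pmf) \<Rightarrow> bool"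
where
  "causal_conditionals E Val P K \<longleftrightarrow>
     (\<forall>j. \<forall>pa \<in> PiE (parents E j) Val.
        set_pmf (K j pa) \<subseteq> Val j \<and>
        (measure_pmf.prob P {\<omega>. \<forall>i\<in>parents E j. \<omega> i = pa i} > 0 \<longrightarrow>
           (\<forall>a. pmf (K j pa) a =
                cond_prob (measure_pmf P) (\<lambda>\<omega>. \<omega> j = a) (\<lambda>\<omega>. \<forall>i\<in>parents E j. \<omega> i = pa i))))"

definition prod_marginals :: "('v \<Rightarrow> 'a) pmf \<Rightarrow> 'v set \<Rightarrow> ('v \<Rightarrow> 'a) \<Rightarrow> real" where
  "prod_marginals P A y = (\<Prod>i\<in>A. pmf (map_pmf (\<lambda>\<omega>. \<omega> i) P) (y i))"

text \<open>
  \<open>P\<^sub>S(x\<^sub>j | pa\<^sub>j)\<close> with the parents along arrows of \<open>S\<close> averaged out; the summation variable \<open>y\<close>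
  is \<open>pa\<^sub>j\<close> restricted to those parents, and the remaining parents take their values from \<open>x\<close>.
\<close>

definition cut_conditional ::
  "('v \<times> 'v) set \<Rightarrow> ('v \<Rightarrow> 'a set) \<Rightarrow> ('v \<Rightarrow> 'a) pmf \<Rightarrow> ('v \<Rightarrow> ('v \<Rightarrow> 'a) \<Rightarrow> 'a pmf) \<Rightarrow>
   ('v \<times> 'v) set \<Rightarrow> 'v \<Rightarrow> ('v \<Rightarrow> 'a) \<Rightarrow> real"
where
  "cut_conditional E Val P K S j x =
     (\<Sum>\<^sub>\<infinity> y \<in> PiE (parents S j) Val.
        pmf (K j (merge (parents (E - S) j) (parents S j) (x, y))) (x j)
        * prod_marginals P (parents S j) y)"

definition interventional ::
  "('v::finite \<times> 'v) set \<Rightarrow> ('v \<Rightarrow> 'a set) \<Rightarrow> ('v \<Rightarrow> 'a) pmf \<Rightarrow> ('v \<Rightarrow> ('v \<Rightarrow> 'a) \<Rightarrow> 'a pmf) \<Rightarrow>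
   ('v \<times> 'v) set \<Rightarrow> ('v \<Rightarrow> 'a) \<Rightarrow> real"
where
  "interventional E Val P K S x = (\<Prod>j\<in>UNIV. cut_conditional E Val P K S j x)"

text \<open>
  Kullback--Leibler divergence with values in \<open>(-\<infinity>, \<infinity>]\<close>. The library constant \<open>KL_divergence\<close> is
  real-valued, hence \<open>0\<close> where the divergence is infinite. If the sum is not absolutely convergent
  its value is \<open>\<infinity>\<close>: for \<open>q \<ge> 0\<close> with total mass at most \<open>1\<close>, \<open>p ln (p / q) \<ge> p - q\<close> shows that the
  negative terms are always summable. The base of the logarithm does not affect vanishing.
\<close>

definition kl_div :: "'b pmf \<Rightarrow> ('b \<Rightarrow> real) \<Rightarrow> ereal" where
  "kl_div p q =
     (if (\<forall>x\<in>set_pmf p. q x > 0) \<and> (\<lambda>x. pmf p x * ln (pmf p x / q x)) summable_on set_pmf p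
      then ereal (\<Sum>\<^sub>\<infinity> x \<in> set_pmf p. pmf p x * ln (pmf p x / q x))
      else \<infinity>)"

definition causal_strength ::
  "('v::finite \<times> 'v) set \<Rightarrow> ('v \<Rightarrow> 'a set) \<Rightarrow> ('v \<Rightarrow> 'a) pmf \<Rightarrow> ('v \<Rightarrow> ('v \<Rightarrow> 'a) \<Rightarrow> 'a pmf) \<Rightarrow>
   ('v \<times> 'v) set \<Rightarrow> ereal"
where
  "causal_strength E Val P K S = kl_div P (interventional E Val P K S)"

end

theory Submission
  imports Defs
begin

text \<open>
  After cutting, each factor of the interventional distribution is a genuine Markov kernel for the
  remaining parents: the former parents along \<open>S\<close> are drawn independently from their marginals. So
  \<open>P\<^sub>S\<close> is a probability distribution, and the equality case of Gibbs' inequality turns vanishing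
  causal strength into \<open>P = P\<^sub>S\<close>. Thus \<open>P\<close> factorizes along \<open>E - S\<close>. Summing out sinks shows that
  the marginal of \<open>P\<close> on any set closed under parents is the product of the kernels in that set; for
  the nondescendants of \<open>j\<close>, with and without \<open>j\<close> itself, this gives the Markov condition.
\<close>

section \<open>Ancestral sets and kernels on a DAG\<close>

definition agree :: "'v set \<Rightarrow> ('v \<Rightarrow> 'a) \<Rightarrow> ('v \<Rightarrow> 'a) set" where
  "agree A x = {\<omega>. \<forall>i\<in>A. \<omega> i = x i}"

definition ancestral :: "('v \<times> 'v) set \<Rightarrow> 'v set \<Rightarrow> bool" where
  "ancestral F A \<longleftrightarrow> (\<forall>j\<in>A. parents F j \<subseteq> A)"

text \<open>Kernels take full assignments as arguments, so dependence on the parents alone becomes a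
  congruence condition.\<close>

definition parental_kernel ::
  "('v \<times> 'v) set \<Rightarrow> ('v \<Rightarrow> ('v \<Rightarrow> 'a) \<Rightarrow> 'a pmf) \<Rightarrow> bool" where
  "parental_kernel F L \<longleftrightarrow> (\<forall>j x y. (\<forall>i\<in>parents F j. x i = y i) \<longrightarrow> L j x = L j y)"

lemma parental_kernelD:
  "parental_kernel F L \<Longrightarrow> (\<And>i. i \<in> parents F j \<Longrightarrow> x i = y i) \<Longrightarrow> L j x = L j y"
  unfolding parental_kernel_def by blast

lemma acyclic_not_parent_self: "acyclic F \<Longrightarrow> j \<notin> parents F j"
  by (auto simp: acyclic_def parents_def)

text \<open>Since \<open>F\<close> is well-founded, a minimal node outside \<open>A\<close> exists,
  and its parents all lie in \<open>A\<close>. Nodes can thus be added one at a time in a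
  topological order.\<close>

lemma ancestral_extension_induct [consumes 2, case_names base step]:
  fixes F :: "('v::finite \<times> 'v) set"
  assumes "acyclic F" and "ancestral F A" and "R A"
    and step: "\<And>B j. R B \<Longrightarrow> ancestral F B \<Longrightarrow> j \<notin> B \<Longrightarrow> parents F j \<subseteq> B \<Longrightarrow> R (insert j B)"
  shows "R UNIV"
  using assms(2,3)
proof (induction "card (- A)" arbitrary: A)
  case 0
  then have "A = UNIV"
    by auto
  with 0 show ?case
    by simp
next
  case (Suc n)
  have "wf F"
    using \<open>acyclic F\<close> by (simp add: finite_acyclic_wf)
  moreover from Suc(2) have "- A \<noteq> {}"
    by auto
  ultimately obtain j where "j \<in> - A" and "\<And>i. (i, j) \<in> F \<Longrightarrow> i \<notin> - A"
    using wfE_min'[of F "- A"] by blast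
  then have j: "j \<notin> A" "parents F j \<subseteq> A"
    by (auto simp: parents_def)
  have "- insert j A = - A - {j}"
    by auto
  then have "n = card (- insert j A)"
    using Suc(2) j(1) by simp
  moreover have "ancestral F (insert j A)"
    using Suc.prems(1) j(2) by (auto simp: ancestral_def)
  ultimately show ?case
    using Suc.hyps(1) step[OF Suc.prems(2,1) j] by blast
qed

section \<open>Products of kernels and their marginals\<close>

text \<open>The codomain of \<open>f\<close> may be uncountable: pairing \<open>f\<close> with
  membership in \<open>B\<close> turns the fibre probabilities into point masses of one
  \<open>pmf\<close>, whose sum is under control.\<close>

lemma
  shows measure_pmf_total_probability:
      "measure (measure_pmf P) B = infsetsum (\<lambda>y. measure (measure_pmf P) (B \<inter> f -` {y})) UNIV"
    and abs_summable_measure_pmf_vimage: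
      "Infinite_Set_Sum.abs_summable_on (\<lambda>y. measure (measure_pmf P) (B \<inter> f -` {y})) UNIV"
proof -
  let ?p = "map_pmf (\<lambda>\<omega>. (\<omega> \<in> B, f \<omega>)) P"
  have eq: "(\<lambda>y. pmf ?p (True, y)) = (\<lambda>y. measure (measure_pmf P) (B \<inter> f -` {y}))"
    unfolding pmf_map by (intro ext arg_cong2[where f = measure]) auto
  have inj: "inj (Pair True)"
    by (auto intro: injI)
  have "measure (measure_pmf P) B = measure (measure_pmf ?p) (Pair True ` UNIV)"
    unfolding measure_map_pmf by (intro arg_cong2[where f = measure]) auto
  also have "\<dots> = infsetsum (\<lambda>y. pmf ?p (True, y)) UNIV"
    unfolding measure_pmf_conv_infsetsum using inj by (rule infsetsum_reindex)
  finally show "measure (measure_pmf P) B =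
      infsetsum (\<lambda>y. measure (measure_pmf P) (B \<inter> f -` {y})) UNIV"
    unfolding eq .
  show "Infinite_Set_Sum.abs_summable_on (\<lambda>y. measure (measure_pmf P) (B \<inter> f -` {y})) UNIV"
    unfolding eq[symmetric] using pmf_abs_summable[of ?p "Pair True ` UNIV"]
    by (subst (asm) abs_summable_on_reindex_iff[OF inj, symmetric])
qed

text \<open>Ancestral sampling: each node is drawn from its kernel at the values drawn before it, so
  total mass 1 comes for free.\<close>

lemma exists_pmf_prod_kernels:
  fixes F :: "('v::finite \<times> 'v) set" and L :: "'v \<Rightarrow> ('v \<Rightarrow> 'a) \<Rightarrow> 'a pmf"
  assumes "acyclic F" and L: "parental_kernel F L"
  shows "\<exists>Q. \<forall>x. pmf Q x = (\<Prod>j\<in>UNIV. pmf (L j x) (x j))"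
proof -
  \<comment> \<open>Nodes not yet drawn hold \<open>undefined\<close>, so partial samples are still
    full assignments; at \<open>UNIV\<close> the side condition is void.\<close>
  let ?R = "\<lambda>A. \<exists>Q. \<forall>x. pmf Q x =
    (if \<forall>i. i \<notin> A \<longrightarrow> x i = undefined then \<Prod>j\<in>A. pmf (L j x) (x j) else 0)"
  have "ancestral F {}"
    by (simp add: ancestral_def)
  with \<open>acyclic F\<close> have "?R UNIV"
  proof (induction rule: ancestral_extension_induct)
    case base
    show ?case
      by (rule exI[of _ "return_pmf (\<lambda>_. undefined)"]) (auto simp: indicator_def)
  next
    case (step B j)
    from step(1) obtain Q where Q: "\<And>x. pmf Q x =
        (if \<forall>i. i \<notin> B \<longrightarrow> x i = undefined then \<Prod>j\<in>B. pmf (L j x) (x j) else 0)"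
      by blast
    define Q' where "Q' = bind_pmf Q (\<lambda>w. map_pmf (\<lambda>a. w(j := a)) (L j w))"
    have "pmf Q' x = (if \<forall>i. i \<notin> insert j B \<longrightarrow> x i = undefined
        then \<Prod>j\<in>insert j B. pmf (L j x) (x j) else 0)" for x
    proof -
      \<comment> \<open>Samples of \<open>Q\<close> are \<open>undefined\<close> at
        \<open>j\<close>, so \<open>z\<close> is the only one that the new draw can turn into
        \<open>x\<close>.\<close>
      define z where "z = x(j := undefined)"
      have Lz: "L i z = L i x" if "i \<in> insert j B" for i
        using that step(2-4) by (intro parental_kernelD[OF L]) (auto simp: z_def ancestral_def)
      have Bz: "(\<Prod>i\<in>B. pmf (L i z) (z i)) = (\<Prod>i\<in>B. pmf (L i x) (x i))"
        using Lz step(3) by (intro prod.cong) (auto simp: z_def)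
      have "pmf (map_pmf (\<lambda>a. w(j := a)) (L j w)) x = indicator {z} w * pmf (L j x) (x j)"
        if "w \<in> set_pmf Q" for w
      proof -
        have "w j = undefined"
          using that step(3) by (auto simp: set_pmf_iff Q split: if_splits)
        then have "w(j := a) = x \<longleftrightarrow> w = z \<and> a = x j" for a
          by (auto simp: z_def fun_eq_iff)
        then have "(\<lambda>a. w(j := a)) -` {x} = (if w = z then {x j} else {})"
          by auto
        then show ?thesis
          using Lz[of j] by (simp add: pmf_map measure_pmf_single)
      qed
      then have "pmf Q' x = (\<integral>w. indicator {z} w * pmf (L j x) (x j) \<partial>measure_pmf Q)"
        unfolding Q'_def pmf_bind by (intro integral_cong_AE) (auto simp: AE_measure_pmf_iff)
      also have "\<dots> = pmf Q z * pmf (L j x) (x j)"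
        by (simp add: measure_pmf_single)
      also have "\<dots> = (if \<forall>i. i \<notin> insert j B \<longrightarrow> x i = undefined
        then \<Prod>j\<in>insert j B. pmf (L j x) (x j) else 0)"
        using step(3) Bz by (auto simp: Q z_def)
      finally show ?thesis .
    qed
    then show ?case
      by blast
  qed
  then show ?thesis
    by simp
qed

text \<open>A node added last to an ancestral set is a parent of no node in it, so its value enters
  only its own kernel, which sums to 1.\<close>

lemma measure_agree_ancestral:
  fixes F :: "('v::finite \<times> 'v) set" and L :: "'v \<Rightarrow> ('v \<Rightarrow> 'a) \<Rightarrow> 'a pmf"
  assumes "acyclic F" and L: "parental_kernel F L"
    and P: "\<And>x. pmf P x = (\<Prod>j\<in>UNIV. pmf (L j x) (x j))"
    and "ancestral F A"
  shows "measure (measure_pmf P) (agree A x) = (\<Prod>j\<in>A. pmf (L j x) (x j))"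
proof -
  let ?M = "\<lambda>B. \<forall>x. measure (measure_pmf P) (agree B x) = (\<Prod>j\<in>B. pmf (L j x) (x j))"
  \<comment> \<open>The induction predicate is \<open>?M B\<close> implies \<open>?M A\<close>;
    growing \<open>B\<close> up to \<open>UNIV\<close> therefore amounts to summing out nodes from
    \<open>UNIV\<close> down to \<open>A\<close>.\<close>
  from assms(1,4) have "?M UNIV \<longrightarrow> ?M A"
  proof (induction rule: ancestral_extension_induct)
    case base
    then show ?case by blast
  next
    case (step B j)
    have "?M B" if M: "?M (insert j B)"
    proof
      fix x
      have "measure (measure_pmf P) (agree B x \<inter> (\<lambda>\<omega>. \<omega> j) -` {a}) =
          pmf (L j x) a * (\<Prod>i\<in>B. pmf (L i x) (x i))" for a
      proof -
        have Lx: "L i (x(j := a)) = L i x" if "i \<in> insert j B" for i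
          using that step(2-4) by (intro parental_kernelD[OF L]) (auto simp: ancestral_def)
        have "agree B x \<inter> (\<lambda>\<omega>. \<omega> j) -` {a} = agree (insert j B) (x(j := a))"
          using step(3) by (auto simp: agree_def)
        then have "measure (measure_pmf P) (agree B x \<inter> (\<lambda>\<omega>. \<omega> j) -` {a}) =
            (\<Prod>i\<in>insert j B. pmf (L i (x(j := a))) ((x(j := a)) i))"
          using M by simp
        also have "\<dots> = pmf (L j x) a * (\<Prod>i\<in>B. pmf (L i (x(j := a))) ((x(j := a)) i))"
          using step(3) Lx[of j] by simp
        also have "(\<Prod>i\<in>B. pmf (L i (x(j := a))) ((x(j := a)) i)) = (\<Prod>i\<in>B. pmf (L i x) (x i))"
          using step(3) Lx by (intro prod.cong) auto
        finally show ?thesis .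
      qed
      then have "measure (measure_pmf P) (agree B x) =
          infsetsum (\<lambda>a. pmf (L j x) a * (\<Prod>i\<in>B. pmf (L i x) (x i))) UNIV"
        by (subst measure_pmf_total_probability[where f = "\<lambda>\<omega>. \<omega> j"]) simp
      also have "\<dots> = (\<Prod>i\<in>B. pmf (L i x) (x i))"
        by (simp add: infsetsum_cmult_left pmf_abs_summable infsetsum_pmf_eq_1)
      finally show "measure (measure_pmf P) (agree B x) = (\<Prod>i\<in>B. pmf (L i x) (x i))" .
    qed
    with step(1) show ?case
      by blast
  qed
  moreover have "agree UNIV x = {x}" for x :: "'v \<Rightarrow> 'a"
    by (auto simp: agree_def)
  ultimately show ?thesis
    using P by (simp add: measure_pmf_single)
qed

section \<open>From factorization to the Markov condition\<close>

lemma cond_of_eq: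
  "cond_of P A C x =
    measure (measure_pmf P) (agree (A \<union> C) x) / measure (measure_pmf P) (agree C x)"
  unfolding cond_of_def cond_prob_def agree_def
  by (intro arg_cong2[where f = "(/)"] arg_cong2[where f = measure]) auto

text \<open>The nondescendants of \<open>j\<close> form an ancestral set, with or without
  \<open>j\<close> added. The two marginals differ by the kernel of \<open>j\<close>, which sees
  only the parents of \<open>j\<close>.\<close>

lemma markovian_if_pmf_eq_prod_kernels:
  fixes F :: "('v::finite \<times> 'v) set" and L :: "'v \<Rightarrow> ('v \<Rightarrow> 'a) \<Rightarrow> 'a pmf"
  assumes F: "acyclic F" and L: "parental_kernel F L"
    and P: "\<And>x. pmf P x = (\<Prod>j\<in>UNIV. pmf (L j x) (x j))"
  shows "markovian F P"
  unfolding markovian_def cond_indep_def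
proof (intro allI)
  fix j x
  define N where "N = nondescendants F j"
  define C where "C = parents F j"
  have j: "j \<notin> N"
    by (simp add: N_def nondescendants_def)
  have CN: "C \<subseteq> N"
    using F by (auto simp: C_def N_def nondescendants_def parents_def acyclic_def
        dest: rtrancl_into_trancl1)
  have N: "ancestral F N"
    by (auto simp: ancestral_def N_def nondescendants_def parents_def dest: rtrancl_into_rtrancl)
  have jN: "ancestral F (insert j N)"
    using N CN by (auto simp: ancestral_def C_def)
  have split: "measure (measure_pmf P) (agree (insert j N) y) =
      pmf (L j y) (y j) * measure (measure_pmf P) (agree N y)" for y
    using measure_agree_ancestral[OF F L P N, of y] measure_agree_ancestral[OF F L P jN, of y] j
    by simp
  \<comment> \<open>\<open>C\<close> need not be ancestral, so \<open>split\<close> is summed over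
    the values on \<open>N\<close> that agree with \<open>x\<close> on \<open>C\<close>; the kernel
    is a common factor.\<close>
  have parental: "measure (measure_pmf P) (agree (insert j C) x) =
      pmf (L j x) (x j) * measure (measure_pmf P) (agree C x)"
  proof -
    let ?f = "\<lambda>w. restrict w N"
    have eq: "measure (measure_pmf P) (agree (insert j C) x \<inter> ?f -` {y}) =
        pmf (L j x) (x j) * measure (measure_pmf P) (agree C x \<inter> ?f -` {y})" for y
    proof (cases "agree C x \<inter> ?f -` {y} = {}")
      case True
      moreover from this have "agree (insert j C) x \<inter> ?f -` {y} = {}"
        by (auto simp: agree_def)
      ultimately show ?thesis
        by simp
    next
      case False
      then obtain w where w: "w \<in> agree C x" "y = restrict w N"
        by auto
      \<comment> \<open>As \<open>j\<close> is outside \<open>N\<close>, the overwriting leaves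
        \<open>agree N w\<close> unchanged and supplies the value \<open>x j\<close> that
        \<open>split\<close> reads.\<close>
      let ?z = "w(j := x j)"
      have restrict_eq: "restrict \<eta> N = restrict w N \<longleftrightarrow> \<eta> \<in> agree N w" for \<eta>
        by (auto simp: agree_def fun_eq_iff restrict_def)
      have "agree C x \<inter> ?f -` {y} = agree N ?z"
        using w CN j by (auto simp: restrict_eq) (auto simp: agree_def)
      moreover have "agree (insert j C) x \<inter> ?f -` {y} = agree (insert j N) ?z"
        using w CN j by (auto simp: restrict_eq) (auto simp: agree_def)
      moreover have "L j ?z = L j x"
        using w CN j by (intro parental_kernelD[OF L]) (auto simp: agree_def C_def)
      ultimately show ?thesis
        using split[of ?z] by simp
    qed
    show ?thesis
      unfolding measure_pmf_total_probability[where f = ?f and B = "agree (insert j C) x"]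
        measure_pmf_total_probability[where f = ?f and B = "agree C x"] eq
      by (rule infsetsum_cmult_right[OF abs_summable_measure_pmf_vimage])
  qed
  have "{j} \<union> N \<union> C = insert j N" "N \<union> C = N"
    using CN by auto
  \<comment> \<open>If the parent event has probability 0, both sides vanish by division by
    zero.\<close>
  then show "cond_of P ({j} \<union> nondescendants F j) (parents F j) x =
      cond_of P {j} (parents F j) x * cond_of P (nondescendants F j) (parents F j) x"
    unfolding N_def[symmetric] C_def[symmetric] cond_of_eq
    by (simp add: split parental)
qed

section \<open>Equality case of Gibbs' inequality\<close>

text \<open>The correction by \<open>- p + q\<close> makes every summand nonnegative, because
  \<open>ln r\<close> is at most \<open>r - 1\<close>, with equality only at \<open>r = 1\<close>.
  The corrected sum is at most 0, so every summand vanishes.\<close>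

lemma kl_div_eq_0_imp_eq:
  assumes "kl_div p (pmf q) = 0"
  shows "p = q"
proof -
  let ?A = "set_pmf p" and ?k = "\<lambda>x. pmf p x * ln (pmf p x / pmf q x)"
  let ?f = "\<lambda>x. ?k x - pmf p x + pmf q x"
  have pos: "pmf q x > 0" if "x \<in> ?A" for x
    using assms that by (auto simp: kl_div_def split: if_splits)
  have k: "?k summable_on ?A" "infsum ?k ?A = 0"
    using assms by (auto simp: kl_div_def zero_ereal_def split: if_splits)
  have pmf_summable: "pmf r summable_on ?A" for r
    using pmf_abs_summable[of r ?A] abs_summable_equivalent abs_summable_summable by blast
  have pmf_sum: "(pmf r has_sum measure (measure_pmf r) ?A) ?A" for r
    using pmf_summable[of r]
    by (simp add: has_sum_iff measure_pmf_conv_infsetsum infsetsum_infsum pmf_abs_summable)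
  have nonneg: "?f x \<ge> 0" and eq: "?f x = 0 \<Longrightarrow> pmf p x = pmf q x" if "x \<in> ?A" for x
  proof -
    let ?r = "pmf q x / pmf p x"
    have p: "pmf p x > 0"
      using that by (simp add: pmf_positive)
    then have r: "?r > 0"
      using pos[OF that] by simp
    have f: "?f x = pmf p x * (?r - 1 - ln ?r)"
      using p pos[OF that] by (simp add: ln_div field_simps)
    show "?f x \<ge> 0"
      unfolding f using p ln_le_minus_one[OF r] by simp
    show "pmf p x = pmf q x" if "?f x = 0"
      using that p ln_eq_minus_one[OF r] unfolding f by simp
  qed
  have "measure (measure_pmf p) ?A = 1"
    by (simp add: measure_pmf.prob_eq_1 AE_measure_pmf_iff)
  moreover have "(?k has_sum 0) ?A"
    using k by (simp add: has_sum_iff)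
  ultimately have "((\<lambda>x. ?k x + - pmf p x + pmf q x)
      has_sum (0 + - 1 + measure (measure_pmf q) ?A)) ?A"
    using pmf_sum[of p] pmf_sum[of q] by (intro has_sum_add has_sum_uminusI) simp_all
  then have "(?f has_sum (measure (measure_pmf q) ?A - 1)) ?A"
    by simp
  moreover have "measure (measure_pmf q) ?A - 1 \<le> 0"
    using measure_pmf.prob_le_1[of q ?A] by linarith
  ultimately have "?f x = 0" if "x \<in> ?A" for x
    using nonneg that by (rule nonneg_has_sum_le_0D)
  with eq have pq: "pmf p x = pmf q x" if "x \<in> ?A" for x
    using that by blast
  \<comment> \<open>So far equality holds only on the support of \<open>p\<close>. Distinct
    \<open>pmf\<close>s have equal mass, so \<open>p\<close> exceeds \<open>q\<close> somewhere,
    necessarily in that support.\<close>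
  show "p = q"
  proof (rule ccontr)
    assume "p \<noteq> q"
    then obtain x where "pmf q x < pmf p x"
      using pmf_neq_exists_less[of q p] by blast
    moreover from this have "x \<in> ?A"
      using pmf_nonneg[of q x] by (auto simp: set_pmf_iff)
    ultimately show False
      using pq by simp
  qed
qed

section \<open>The interventional distribution as a product of kernels\<close>

definition cut_kernel ::
  "('v::finite \<times> 'v) set \<Rightarrow> ('v \<Rightarrow> 'a) pmf \<Rightarrow> ('v \<Rightarrow> ('v \<Rightarrow> 'a) \<Rightarrow> 'a pmf) \<Rightarrow>
   ('v \<times> 'v) set \<Rightarrow> 'v \<Rightarrow> ('v \<Rightarrow> 'a) \<Rightarrow> 'a pmf"
where
  "cut_kernel E P K S j x =
     bind_pmf (Pi_pmf (parents S j) undefined (\<lambda>i. map_pmf (\<lambda>\<omega>. \<omega> i) P))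
       (\<lambda>y. K j (merge (parents (E - S) j) (parents S j) (x, y)))"

lemma parental_kernel_cut_kernel:
  fixes E S :: "('v::finite \<times> 'v) set" and P :: "('v \<Rightarrow> 'a) pmf"
  shows "parental_kernel (E - S) (cut_kernel E P K S)"
proof -
  have "merge (parents (E - S) j) B (x, z) = merge (parents (E - S) j) B (y, z)"
    if "\<forall>i\<in>parents (E - S) j. x i = y i" for j B and x y z :: "'v \<Rightarrow> 'a"
    using that by (auto simp: merge_def fun_eq_iff)
  then show ?thesis
    unfolding parental_kernel_def cut_kernel_def
    by (intro allI impI bind_pmf_cong refl arg_cong2[where f = K]) blast
qed

text \<open>Expanding the bind gives a sum over all \<open>y\<close>. Terms outside
  \<open>PiE\<close> vanish: the marginals live on \<open>Val\<close>, and the default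
  \<open>undefined\<close> of \<open>Pi_pmf\<close> is the one that \<open>PiE\<close>
  demands.\<close>

lemma cut_conditional_eq_pmf_cut_kernel:
  assumes "set_pmf P \<subseteq> Pi UNIV Val"
  shows "cut_conditional E Val P K S j x = pmf (cut_kernel E P K S j x) (x j)"
proof -
  let ?B = "parents S j"
  let ?Q = "Pi_pmf ?B undefined (\<lambda>i. map_pmf (\<lambda>\<omega>. \<omega> i) P)"
  let ?g = "\<lambda>y. pmf (K j (merge (parents (E - S) j) ?B (x, y))) (x j)"
  have "Infinite_Set_Sum.abs_summable_on (\<lambda>y. pmf ?Q y * ?g y) UNIV"
    by (rule abs_summable_on_comparison_test[OF pmf_abs_summable[of ?Q UNIV]])
      (simp add: pmf_le_1 mult_left_le)
  then have "pmf (cut_kernel E P K S j x) (x j) = (\<Sum>\<^sub>\<infinity>y. pmf ?Q y * ?g y)"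
    by (simp add: cut_kernel_def pmf_bind pmf_expectation_eq_infsetsum infsetsum_infsum)
  also have "\<dots> = (\<Sum>\<^sub>\<infinity>y\<in>PiE ?B Val. ?g y * prod_marginals P ?B y)"
  proof (rule infsum_cong_neutral)
    fix y assume "y \<in> UNIV - PiE ?B Val"
    then consider i where "i \<in> ?B" "y i \<notin> Val i" | i where "i \<notin> ?B" "y i \<noteq> undefined"
      by (auto simp: PiE_def extensional_def)
    then have "pmf ?Q y = 0"
    proof cases
      case 1
      then have "y i \<notin> set_pmf (map_pmf (\<lambda>\<omega>. \<omega> i) P)"
        using assms by (auto simp: Pi_def)
      then have "pmf (map_pmf (\<lambda>\<omega>. \<omega> i) P) (y i) = 0"
        unfolding set_pmf_iff by blast
      with 1 show ?thesis
        by (auto simp: pmf_Pi intro!: prod_zero)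
    next
      case 2
      then show ?thesis
        by (auto simp: pmf_Pi)
    qed
    then show "pmf ?Q y * ?g y = 0"
      by simp
  next
    fix y assume "y \<in> UNIV \<inter> PiE ?B Val"
    then show "pmf ?Q y * ?g y = ?g y * prod_marginals P ?B y"
      by (subst pmf_Pi') (auto simp: prod_marginals_def)
  qed auto
  finally show ?thesis
    by (simp add: cut_conditional_def)
qed

theorem mainTheorem1:
  fixes E S :: "('v::finite \<times> 'v) set"
    and Val :: "'v \<Rightarrow> 'a set"
    and P :: "('v \<Rightarrow> 'a) pmf"
    and K :: "'v \<Rightarrow> ('v \<Rightarrow> 'a) \<Rightarrow> 'a pmf"
  assumes "acyclic E"
    and "\<And>i. countable (Val i)"
    and "set_pmf P \<subseteq> Pi UNIV Val"
    and "markovian E P"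
    and "causal_conditionals E Val P K"
    and "S \<subseteq> E"
    and "causal_strength E Val P K S = 0"
  shows "markovian (E - S) P"
proof -
  let ?L = "cut_kernel E P K S"
  have acyclic: "acyclic (E - S)"
    using \<open>acyclic E\<close> by (rule acyclic_subset) auto
  \<comment> \<open>The Gibbs lemma compares two \<open>pmf\<close>s, so the interventional
    distribution is first realized as one.\<close>
  obtain Q where Q: "\<And>x. pmf Q x = (\<Prod>j\<in>UNIV. pmf (?L j x) (x j))"
    using exists_pmf_prod_kernels[OF acyclic parental_kernel_cut_kernel] by blast
  have "interventional E Val P K S = pmf Q"
    by (simp add: fun_eq_iff interventional_def Q
        cut_conditional_eq_pmf_cut_kernel[OF \<open>set_pmf P \<subseteq> Pi UNIV Val\<close>])
  then have "P = Q"
    using \<open>causal_strength E Val P K S = 0\<close>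
    by (auto simp: causal_strength_def intro: kl_div_eq_0_imp_eq)
  then show ?thesis
    using markovian_if_pmf_eq_prod_kernels[OF acyclic parental_kernel_cut_kernel] Q by blast
qed

end
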